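(* Let $\pi=(\pi_x)_x$ be a discrete probability distribution, let $\xi_1,\xi_2,\dots$ be i.i.d. random variables with common law $\pi$, and for each $n\ge 1$ let $R_n=\#\{\xi_1,\dots,\xi_n\}$ be the number of distinct values among the first $n$ samples. Let $S(\pi)=\sum_x -\pi_x\log\pi_x\in[0,\infty]$ be the entropy of $\pi$. Then: (i) In general (with no assumption on $S(\pi)$), almost surely $$\lim_{n\to\infty}\frac{R_n}{n}=0.$$ (ii) If $S(\pi)<\infty$, then almost surely $$\lim_{n\to\infty}\frac{\log n}{n}\cdot R_n=0.$$ (iii) If $S(\pi)=\infty$, then almost surely $$\limsup_{n\to\infty}\frac{(\log n)^{1+\varepsilon}}{n}\cdot R_n=\infty\qquad\text{for all }\varepsilon>0.$$
   Context: A discrete probability distribution is a probability measure $\pi$ on a countable set, with $\pi_x$ the mass of the point $x$. Here $\log$ is the natural logarithm, and in the entropy $S(\pi)=\sum_x-\pi_x\log\pi_x$ the convention $0\log 0=0$ is used; the sum has nonnegative terms and may equal $+\infty$. *)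

theory Defs
  imports "HOL-Probability.Probability"
begin

text \<open>
  A discrete probability distribution is a \<^typ>\<open>'a pmf\<close>; its support is automatically countable.
  The entropy is a sum of nonnegative terms with values in [0,\<infinity>], hence of type \<^typ>\<open>ennreal\<close>,
  with the sum written as an integral with respect to counting measure. The convention
  0 log 0 = 0 holds automatically because of the factor 0.
\<close>

definition pmf_entropy :: "'a pmf \<Rightarrow> ennreal" where
  "pmf_entropy p = (\<integral>\<^sup>+ x. ennreal (- pmf p x * ln (pmf p x)) \<partial>count_space UNIV)"

text \<open>Samples are indexed from 1, so the value of the sequence at index 0 is ignored.\<close>

definition num_distinct :: "(nat \<Rightarrow> 'w \<Rightarrow> 'a) \<Rightarrow> nat \<Rightarrow> 'w \<Rightarrow> nat" where
  "num_distinct \<xi> n \<omega> = card ((\<lambda>i. \<xi> i \<omega>) ` {1..n})"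

end

theory Submission
  imports Defs "HOL-Real_Asymp.Real_Asymp"
begin

text \<open>
  Write \<open>p\<close> for the law, and call a value light at level \<open>t\<close> if its mass is at most \<open>t\<close>. All three
  claims come from two almost sure estimates of \<open>R n\<close>, the number of distinct values among the
  first \<open>n\<close> samples. In both, the number of the first \<open>n\<close> samples that fall into a set
  \<open>A n\<close> is binomial. By Hoeffding's inequality and the Borel--Cantelli lemma it is eventually
  within \<open>n powr (3/4)\<close> of its mean \<open>n * p (A n)\<close> (\<open>AE_hits_close\<close>), and this error is
  negligible for every normalization in question. What remains is deterministic.

  Upper estimate (\<open>AE_num_distinct_le\<close>). There are only finitely many values heavier than \<open>1/n\<close>,
  and every other value seen costs at least one light sample. Hence \<open>R n / n\<close> is, up to the error,
  at most \<open>f n\<close>, the sum over \<open>x\<close> of \<open>min (1/n) (p x)\<close>. Dominated convergence gives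
  \<open>f n \<longlonglongrightarrow> 0\<close> with the majorant \<open>p x\<close>; if the entropy is finite, it gives
  \<open>ln n * f n \<longlonglongrightarrow> 0\<close> with the majorant \<open>p x - p x * ln (p x)\<close>
  (\<open>ln_mult_min_le\<close>).

  Lower estimate (\<open>AE_num_distinct_ge\<close>). Two given samples agree in a value of mass at most
  \<open>1/n^4\<close> with probability at most \<open>1/n^4\<close>, so some pair among the first \<open>n\<close> does with
  probability at most \<open>1/n^2\<close>, which is summable. Almost surely, therefore, the samples of such
  light values are eventually all distinct, and \<open>R n\<close> is at least their number, about
  \<open>n * q n\<close>, where \<open>q n\<close> is the probability that a sample is light at level \<open>1/n^4\<close>. The power 4 only rescales
  the logarithm of the level. If \<open>(ln n) powr (1 + \<epsilon>) * R n / n\<close> stayed bounded, then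
  \<open>q (2^k)\<close> would be \<open>O(k powr -(1 + \<epsilon>))\<close>, hence summable in \<open>k\<close>; but the sum of these tail
  probabilities of \<open>- ln (p x)\<close> bounds the entropy up to a constant
  (\<open>pmf_entropy_finite_if_summable\<close>).
\<close>

section \<open>Truncated mass and entropy of a discrete distribution\<close>

lemma finite_pmf_gt:
  assumes "t > 0"
  shows "finite {x. pmf p x > t}"
proof -
  have "card G \<le> nat \<lfloor>1 / t\<rfloor>" if "G \<subseteq> {x. pmf p x > t}" "finite G" for G
  proof -
    \<comment> \<open>More than \<open>1/t\<close> values of mass above \<open>t\<close> would have total mass above 1.\<close>
    have "t * real (card G) = (\<Sum>x\<in>G. t)" by simp
    also have "\<dots> \<le> (\<Sum>x\<in>G. pmf p x)"
      using that(1) by (intro sum_mono) auto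
    also have "\<dots> = measure_pmf.prob p G"
      using that(2) by (simp add: measure_measure_pmf_finite)
    also have "\<dots> \<le> 1" by simp
    finally have "real (card G) \<le> 1 / t"
      using assms by (simp add: field_simps)
    then show ?thesis by linarith
  qed
  then show ?thesis
    using finite_if_finite_subsets_card_bdd[of "{x. pmf p x > t}"] by blast
qed

text \<open>
  For \<open>t = 1/n\<close>, multiplied by \<open>n\<close>, this is the sum of \<open>min 1 (n * pmf p x)\<close>, the union bound
  for the expected number of distinct values among \<open>n\<close> samples.
\<close>

definition truncated_mass :: "'a pmf \<Rightarrow> real \<Rightarrow> real" where
  "truncated_mass p t = (\<integral>x. min t (pmf p x) \<partial>count_space UNIV)"

lemma truncated_mass_eq:
  assumes "t > 0"
  shows "truncated_mass p t = t * real (card {x. pmf p x > t}) + measure_pmf.prob p {x. pmf p x \<le> t}"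
proof -
  let ?F = "{x. pmf p x > t}" and ?A = "{x. pmf p x \<le> t}"
  have "integrable (count_space UNIV) (\<lambda>x. t * indicat_real ?F x)"
    using finite_pmf_gt[OF assms, of p] by (intro integrable_mult_right integrable_real_indicator)
      (auto simp: of_nat_less_top)
  moreover have "integrable (count_space UNIV) (\<lambda>x. indicat_real ?A x * pmf p x)"
    by (rule Bochner_Integration.integrable_bound[OF integrable_pmf[of UNIV p]])
      (auto simp: indicator_def)
  moreover have "(\<lambda>x. min t (pmf p x)) = (\<lambda>x. t * indicat_real ?F x + indicat_real ?A x * pmf p x)"
    by (auto simp: indicator_def fun_eq_iff)
  moreover have "(\<integral>x. indicat_real ?A x * pmf p x \<partial>count_space UNIV) = measure_pmf.prob p ?A"
    using integral_restrict_space[of ?A "count_space UNIV" "pmf p"]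
    by (simp add: restrict_count_space integral_pmf)
  ultimately show ?thesis
    using finite_pmf_gt[OF assms, of p] by (simp add: truncated_mass_def)
qed


text \<open>
  The weight \<open>w\<close> is later the constant 1, with the masses themselves as majorant, or the
  logarithm, whose majorant is summable because the entropy is finite.
\<close>

lemma tendsto_weighted_truncated_mass:
  fixes p :: "'a pmf" and w :: "nat \<Rightarrow> real"
  assumes g: "integrable (count_space UNIV) g"
    and bound: "\<And>n x. \<bar>w n\<bar> * min (1 / real n) (pmf p x) \<le> g x"
    and w: "(\<lambda>n. w n / real n) \<longlonglongrightarrow> 0"
  shows "(\<lambda>n. w n * truncated_mass p (1 / real n)) \<longlonglongrightarrow> 0"
proof -
  have "(\<lambda>n. \<integral>x. w n * min (1 / real n) (pmf p x) \<partial>count_space UNIV)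
      \<longlonglongrightarrow> (\<integral>x. 0 \<partial>count_space (UNIV :: 'a set))"
  proof (rule integral_dominated_convergence[where w = g])
    have "(\<lambda>n. w n * min (1 / real n) (pmf p x)) \<longlonglongrightarrow> 0" for x
    proof (rule Lim_null_comparison)
      show "\<forall>\<^sub>F n in sequentially. norm (w n * min (1 / real n) (pmf p x)) \<le> \<bar>w n / real n\<bar>"
        by (intro always_eventually allI)
          (auto simp: abs_mult divide_inverse intro!: mult_left_mono)
      show "(\<lambda>n. \<bar>w n / real n\<bar>) \<longlonglongrightarrow> 0"
        using w by (rule tendsto_rabs_zero)
    qed
    then show "AE x in count_space UNIV. (\<lambda>n. w n * min (1 / real n) (pmf p x)) \<longlonglongrightarrow> 0"
      by simp
    show "AE x in count_space UNIV. norm (w n * min (1 / real n) (pmf p x)) \<le> g x" for n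
      using bound[of n] by (auto simp: abs_mult)
  qed (use g in auto)
  then show ?thesis by (simp add: truncated_mass_def)
qed

text \<open>
  The majorant for the logarithmic weight. For \<open>0 < t \<le> 1/n\<close> one simply has \<open>ln n \<le> - ln t\<close>. For
  \<open>t > 1/n\<close> the left side is \<open>\<phi> (1/n)\<close> with the concave function \<open>\<phi> s = - s * ln s\<close>, which
  lies below its tangent at \<open>t\<close>. As \<open>\<phi>\<close> is not monotone on the unit interval, \<open>\<phi> t\<close> alone
  is not a bound; the additional summand \<open>t\<close> repairs this.
\<close>

lemma ln_mult_min_le:
  fixes t :: real
  assumes "0 \<le> t" "t \<le> 1" "n \<ge> 1"
  shows "ln (real n) * min (1 / real n) t \<le> t + - t * ln t"
proof (cases "t \<le> 1 / real n")
  case True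
  show ?thesis
  proof (cases "t = 0")
    case False
    then have "ln t \<le> ln (1 / real n)"
      using True assms by (subst ln_le_cancel_iff) auto
    then have "ln (real n) \<le> - ln t"
      using assms by (simp add: ln_div)
    then have "t * ln (real n) \<le> t * - ln t"
      using assms by (intro mult_left_mono) auto
    then show ?thesis using True assms by (simp add: min_absorb2 mult.commute)
  qed (use assms in auto)
next
  case False
  define s where "s = 1 / real n"
  have s: "0 < s" "s < t" using False assms by (auto simp: s_def)
  \<comment> \<open>The tangent inequality for \<open>ln\<close> at 1, rescaled.\<close>
  have "ln (t / s) \<le> t / s - 1"
    using s by (intro ln_le_minus_one) auto
  then have "s * ln (t / s) \<le> s * (t / s - 1)"
    using s by (intro mult_left_mono) auto
  then have "s * ln t - s * ln s \<le> t - s"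
    using s by (simp add: ln_div algebra_simps)
  \<comment> \<open>Here \<open>ln t \<le> 0\<close>, so passing from \<open>s\<close> to the larger \<open>t\<close> lowers the product.\<close>
  moreover have "t * ln t \<le> s * ln t"
    using s assms by (intro mult_right_mono_neg) auto
  ultimately have "s * - ln s \<le> t + - t * ln t"
    using s by simp
  moreover have "ln (real n) = - ln s"
    using assms by (simp add: s_def ln_div)
  ultimately show ?thesis using s by (simp add: min_absorb1 mult.commute flip: s_def)
qed

lemma pmf_mult_ln_nonpos: "pmf p x * ln (pmf p x) \<le> 0"
  by (cases "pmf p x = 0")
    (auto intro!: mult_nonneg_nonpos simp: pmf_le_1 pmf_positive_iff set_pmf_iff)

lemma integrable_entropy_density:
  assumes "pmf_entropy p < \<infinity>"
  shows "integrable (count_space UNIV) (\<lambda>x. - pmf p x * ln (pmf p x))"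
proof (rule integrableI_nonneg)
  show "AE x in count_space UNIV. 0 \<le> - pmf p x * ln (pmf p x)"
    using pmf_mult_ln_nonpos[of p] by simp
qed (use assms in \<open>auto simp: pmf_entropy_def\<close>)

text \<open>
  A layer-cake bound: the entropy is the mean of \<open>- ln (pmf p x)\<close>, and on the support the \<open>k\<close>-th
  event says that this quantity is at least \<open>4 * k * ln 2\<close>. A nonnegative number \<open>z\<close> is at most the
  number of \<open>k \<ge> 0\<close> with \<open>k \<le> z\<close>. The levels are written as fourth powers to match
  \<open>AE_num_distinct_ge\<close> along \<open>n = 2^k\<close>.
\<close>

lemma pmf_entropy_finite_if_summable:
  assumes "summable (\<lambda>k. measure_pmf.prob p {x. pmf p x \<le> 1 / real (2 ^ k) ^ 4})"
  shows "pmf_entropy p < \<infinity>"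
proof -
  define A where "A k = {x. pmf p x \<le> 1 / real (2 ^ k) ^ 4}" for k :: nat
  have pointwise: "ennreal (- ln (pmf p x)) \<le> ennreal (4 * ln 2) * (\<Sum>k. indicator (A k) x)"
    if "x \<in> set_pmf p" for x
  proof -
    define z where "z = - ln (pmf p x) / (4 * ln 2)"
    have pos: "0 < pmf p x" using that by (simp add: pmf_positive)
    have "z \<ge> 0"
      using pos by (simp add: z_def pmf_le_1 field_simps)
    define m where "m = Suc (nat \<lfloor>z\<rfloor>)"
    have "z \<le> real m" using \<open>z \<ge> 0\<close> unfolding m_def by linarith
    have in_A: "x \<in> A k" if "k < m" for k
    proof -
      have "real k \<le> z"
        using that \<open>z \<ge> 0\<close> unfolding m_def by linarith
      then have "ln (pmf p x) \<le> - (4 * real k * ln 2)"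
        by (simp add: z_def field_simps)
      also have "\<dots> = ln (1 / real (2 ^ k) ^ 4)"
        by (simp add: ln_div ln_realpow)
      finally show ?thesis
        using pos by (simp add: A_def)
    qed
    have "ennreal (- ln (pmf p x)) = ennreal (4 * ln 2 * z)"
      by (simp add: z_def)
    also have "\<dots> \<le> ennreal (4 * ln 2 * real m)"
      using \<open>z \<le> real m\<close> by (intro ennreal_leI mult_left_mono) auto
    also have "\<dots> = ennreal (4 * ln 2) * of_nat m"
      by (simp add: ennreal_mult ennreal_of_nat_eq_real_of_nat)
    also have "of_nat m = (\<Sum>k<m. indicator (A k) x :: ennreal)"
      using in_A by simp
    also have "\<dots> \<le> (\<Sum>k. indicator (A k) x)"
      by (intro sum_le_suminf) auto
    finally show ?thesis by (simp add: mult_left_mono)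
  qed
  have "pmf_entropy p = (\<integral>\<^sup>+x. ennreal (- ln (pmf p x)) \<partial>measure_pmf p)"
    unfolding pmf_entropy_def nn_integral_measure_pmf
    by (intro nn_integral_cong) (simp flip: ennreal_mult')
  also have "\<dots> \<le> (\<integral>\<^sup>+x. ennreal (4 * ln 2) * (\<Sum>k. indicator (A k) x) \<partial>measure_pmf p)"
    by (intro nn_integral_mono_AE) (auto simp: AE_measure_pmf_iff pointwise)
  also have "\<dots> = ennreal (4 * ln 2) * (\<Sum>k. emeasure (measure_pmf p) (A k))"
    by (simp add: nn_integral_cmult nn_integral_suminf)
  also have "(\<Sum>k. emeasure (measure_pmf p) (A k)) = ennreal (\<Sum>k. measure_pmf.prob p (A k))"
    using assms unfolding A_def
    by (simp add: measure_pmf.emeasure_eq_measure suminf_ennreal2)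
  also have "ennreal (4 * ln 2) * \<dots> < \<infinity>"
    by (simp add: ennreal_mult_less_top)
  finally show ?thesis .
qed

section \<open>Counting the samples in a set\<close>

locale iid_pmf_samples = prob_space M for M :: "'w measure" +
  fixes p :: "'a pmf" and \<xi> :: "nat \<Rightarrow> 'w \<Rightarrow> 'a"
  assumes indep: "indep_vars (\<lambda>_. count_space UNIV) \<xi> {1..}"
    and law: "\<And>i. i \<ge> 1 \<Longrightarrow> distr M (count_space UNIV) (\<xi> i) = measure_pmf p"
begin

lemma measurable_sample [measurable]:
  "i \<ge> 1 \<Longrightarrow> \<xi> i \<in> measurable M (count_space UNIV)"
  using indep by (auto simp: indep_vars_def)

lemma prob_sample:
  assumes "i \<ge> 1"
  shows "prob (\<xi> i -` A \<inter> space M) = measure_pmf.prob p A"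
proof -
  have "measure (distr M (count_space UNIV) (\<xi> i)) A = prob (\<xi> i -` A \<inter> space M)"
    using assms by (intro measure_distr) auto
  then show ?thesis using law[OF assms] by simp
qed

lemma sets_sample:
  "i \<ge> 1 \<Longrightarrow> \<xi> i -` A \<inter> space M \<in> events"
  by (rule measurable_sets[OF measurable_sample]) auto

definition hits :: "'a set \<Rightarrow> nat \<Rightarrow> 'w \<Rightarrow> nat" where
  "hits A n \<omega> = card {i \<in> {1..n}. \<xi> i \<omega> \<in> A}"

lemma hits_eq_sum: "real (hits A n \<omega>) = (\<Sum>i\<in>{1..n}. indicat_real A (\<xi> i \<omega>))"
  unfolding hits_def
  by (simp add: indicator_def sum.If_cases Int_def)

lemma hits_deviation:
  assumes "n \<ge> 1" "s \<ge> 0"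
  shows "prob {\<omega> \<in> space M. \<bar>real (hits A n \<omega>) - real n * measure_pmf.prob p A\<bar> \<ge> s}
           \<le> 2 * exp (- 2 * s\<^sup>2 / real n)"
proof -
  have exp_eq: "expectation (\<lambda>\<omega>. indicat_real A (\<xi> i \<omega>)) = measure_pmf.prob p A" if "i \<in> {1..n}" for i
  proof -
    have "expectation (\<lambda>\<omega>. indicat_real A (\<xi> i \<omega>))
        = integral\<^sup>L (distr M (count_space UNIV) (\<xi> i)) (indicat_real A)"
      using that by (intro integral_distr[symmetric]) auto
    then show ?thesis using law[of i] that by simp
  qed
  have ind: "indep_vars (\<lambda>_. borel) (\<lambda>i \<omega>. indicat_real A (\<xi> i \<omega>)) {1..n}"
    by (rule indep_vars_compose2[OF indep_vars_subset[OF indep]]) auto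
  interpret H: Hoeffding_ineq M "{1..n}" "\<lambda>i \<omega>. indicat_real A (\<xi> i \<omega>)" "\<lambda>_. 0" "\<lambda>_. 1"
    "real n * measure_pmf.prob p A"
  proof unfold_locales
    show "indep_vars (\<lambda>_. borel) (\<lambda>i \<omega>. indicat_real A (\<xi> i \<omega>)) {1..n}" by (rule ind)
    show "real n * measure_pmf.prob p A
        \<equiv> \<Sum>i\<in>{1..n}. expectation (\<lambda>\<omega>. indicat_real A (\<xi> i \<omega>))"
      by (rule eq_reflection) (simp add: exp_eq)
    show "AE \<omega> in M. indicat_real A (\<xi> i \<omega>) \<in> {0..1}" for i
      by simp
  qed simp
  show ?thesis
    using H.Hoeffding_ineq_abs_ge[OF assms(2)] assms(1) by (simp add: hits_eq_sum)
qed

text \<open>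
  The sets may vary with \<open>n\<close>, so the strong law of large numbers does not apply; a
  deviation bound that is summable in \<open>n\<close> takes its place. Any exponent strictly between 1/2 and
  1 would serve as well as 3/4: above 1/2 the Hoeffding bounds are summable, and below 1 the error
  stays negligible against \<open>n\<close> after multiplication by any power of \<open>ln n\<close>.
\<close>

lemma AE_hits_close:
  "AE \<omega> in M. \<forall>\<^sub>F n in sequentially.
     \<bar>real (hits (A n) n \<omega>) - real n * measure_pmf.prob p (A n)\<bar> < real n powr (3/4)"
proof -
  define B where "B n = {\<omega> \<in> space M. \<bar>real (hits (A n) n \<omega>) - real n * measure_pmf.prob p (A n)\<bar>
      \<ge> real n powr (3/4)}" for n
  have [measurable]: "(\<lambda>\<omega>. real (hits (A n) n \<omega>)) \<in> borel_measurable M" for n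
    unfolding hits_eq_sum
    by (intro borel_measurable_sum measurable_compose[OF measurable_sample]) auto
  have B: "B n \<in> events" for n
    unfolding B_def by measurable
  have bound: "norm (prob (B n)) \<le> 2 * exp (- 2 * real n powr (1/2))" if "n \<ge> 1" for n
  proof -
    have "(real n powr (3/4))\<^sup>2 = real n powr (3/4 + 3/4)"
      unfolding powr_add by (simp add: power2_eq_square)
    also have "\<dots> = real n powr (1/2 + 1)" by simp
    also have "\<dots> = real n powr (1/2) * real n"
      unfolding powr_add using that by simp
    finally have "(real n powr (3/4))\<^sup>2 / real n = real n powr (1/2)"
      using that by simp
    then show ?thesis
      using hits_deviation[OF that, of "real n powr (3/4)" "A n"]
      by (simp add: B_def flip: times_divide_eq_right)
  qed
  have "summable (\<lambda>n. 2 * exp (- 2 * real n powr (1/2)))"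
  proof (rule summable_comparison_test_bigo)
    show "summable (\<lambda>n. norm (inverse (real n ^ 2)))"
      using inverse_power_summable[of 2, where 'a=real] by simp
    show "(\<lambda>n. 2 * exp (- 2 * real n powr (1/2))) \<in> O(\<lambda>n. inverse (real n ^ 2))"
      by real_asymp
  qed
  then have "summable (\<lambda>n. prob (B n))"
    by (rule summable_comparison_test') (use bound in auto)
  then have "AE \<omega> in M. \<forall>\<^sub>F n in sequentially. \<omega> \<in> space M - B n"
    using B by (intro borel_cantelli_AE1) (auto simp: emeasure_eq_measure)
  then show ?thesis
    by (rule AE_mp) (intro AE_I2 impI, auto elim!: eventually_mono simp: B_def not_le)
qed

lemma num_distinct_le_hits:
  assumes "finite F"
  shows "num_distinct \<xi> n \<omega> \<le> card F + hits (- F) n \<omega>"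
proof -
  have "(\<lambda>i. \<xi> i \<omega>) ` {1..n} \<subseteq> F \<union> (\<lambda>i. \<xi> i \<omega>) ` {i \<in> {1..n}. \<xi> i \<omega> \<in> - F}"
    by auto
  then have "num_distinct \<xi> n \<omega> \<le> card (F \<union> (\<lambda>i. \<xi> i \<omega>) ` {i \<in> {1..n}. \<xi> i \<omega> \<in> - F})"
    unfolding num_distinct_def using assms by (intro card_mono) auto
  also have "\<dots> \<le> card F + card ((\<lambda>i. \<xi> i \<omega>) ` {i \<in> {1..n}. \<xi> i \<omega> \<in> - F})"
    by (rule card_Un_le)
  also have "card ((\<lambda>i. \<xi> i \<omega>) ` {i \<in> {1..n}. \<xi> i \<omega> \<in> - F}) \<le> hits (- F) n \<omega>"
    unfolding hits_def by (rule card_image_le) auto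
  finally show ?thesis by simp
qed

section \<open>The upper estimate\<close>

text \<open>
  The finite set of heavy values is \<open>{x. pmf p x > 1/n}\<close>. This threshold balances the two terms of
  \<open>num_distinct_le_hits\<close>: together they form exactly \<open>n\<close> times the truncated mass.
\<close>

lemma AE_num_distinct_le:
  "AE \<omega> in M. \<forall>\<^sub>F n in sequentially.
     real (num_distinct \<xi> n \<omega>) \<le> real n * truncated_mass p (1 / real n) + real n powr (3/4)"
  using AE_hits_close[of "\<lambda>n. {x. pmf p x \<le> 1 / real n}"]
proof (rule AE_mp, intro AE_I2 impI)
  fix \<omega>
  assume "\<forall>\<^sub>F n in sequentially. \<bar>real (hits {x. pmf p x \<le> 1 / real n} n \<omega>)
      - real n * measure_pmf.prob p {x. pmf p x \<le> 1 / real n}\<bar> < real n powr (3/4)"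
  then show "\<forall>\<^sub>F n in sequentially. real (num_distinct \<xi> n \<omega>)
      \<le> real n * truncated_mass p (1 / real n) + real n powr (3/4)"
    using eventually_gt_at_top[of 0]
  proof eventually_elim
    case (elim n)
    let ?F = "{x. pmf p x > 1 / real n}"
    have compl: "- ?F = {x. pmf p x \<le> 1 / real n}" by auto
    have "num_distinct \<xi> n \<omega> \<le> card ?F + hits (- ?F) n \<omega>"
      using elim by (intro num_distinct_le_hits finite_pmf_gt) auto
    moreover have "real n * truncated_mass p (1 / real n)
        = real (card ?F) + real n * measure_pmf.prob p (- ?F)"
      unfolding compl using elim by (simp add: truncated_mass_eq distrib_left)
    ultimately show ?case using elim unfolding compl by linarith
  qed
qed

lemma AE_weighted_num_distinct_tendsto_0:
  fixes w :: "nat \<Rightarrow> real"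
  assumes g: "integrable (count_space UNIV) g"
    and bound: "\<And>n x. \<bar>w n\<bar> * min (1 / real n) (pmf p x) \<le> g x"
    and w: "(\<lambda>n. w n * real n powr (-1/4)) \<longlonglongrightarrow> 0"
  shows "AE \<omega> in M. (\<lambda>n. w n / real n * real (num_distinct \<xi> n \<omega>)) \<longlonglongrightarrow> 0"
proof -
  have "(\<lambda>n. w n / real n) \<longlonglongrightarrow> 0"
  proof (rule Lim_null_comparison)
    show "\<forall>\<^sub>F n in sequentially. norm (w n / real n) \<le> \<bar>w n * real n powr (-1/4)\<bar>"
      using eventually_ge_at_top[of 1]
    proof eventually_elim
      case (elim n)
      then have "real n powr (-1) \<le> real n powr (-1/4)"
        by (intro powr_mono) auto
      moreover have "real n powr (-1) = inverse (real n)"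
        using elim by (simp add: powr_minus)
      ultimately have "\<bar>w n\<bar> * inverse (real n) \<le> \<bar>w n\<bar> * real n powr (-1/4)"
        by (intro mult_left_mono) auto
      moreover have "\<bar>w n / real n\<bar> = \<bar>w n\<bar> * inverse (real n)"
        by (simp add: divide_inverse abs_mult)
      ultimately show ?case
        by (simp only: abs_mult real_norm_def) simp
    qed
    show "(\<lambda>n. \<bar>w n * real n powr (-1/4)\<bar>) \<longlonglongrightarrow> 0"
      using w by (rule tendsto_rabs_zero)
  qed
  note mass = tendsto_weighted_truncated_mass[OF g bound this]
  show ?thesis
    using AE_num_distinct_le
  proof (rule AE_mp, intro AE_I2 impI)
    fix \<omega>
    assume "\<forall>\<^sub>F n in sequentially. real (num_distinct \<xi> n \<omega>)
        \<le> real n * truncated_mass p (1 / real n) + real n powr (3/4)"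
    then have "\<forall>\<^sub>F n in sequentially. norm (w n / real n * real (num_distinct \<xi> n \<omega>))
        \<le> \<bar>w n * truncated_mass p (1 / real n)\<bar> + \<bar>w n * real n powr (-1/4)\<bar>"
      using eventually_gt_at_top[of 0]
    proof eventually_elim
      case (elim n)
      have "real n powr (3/4) = real n * real n powr (-1/4)"
        using elim powr_add[of "real n" 1 "-1/4"] by simp
      then have "real (num_distinct \<xi> n \<omega>)
          \<le> real n * (truncated_mass p (1 / real n) + real n powr (-1/4))"
        using elim by (simp add: distrib_left)
      then have "real (num_distinct \<xi> n \<omega>) / real n
          \<le> truncated_mass p (1 / real n) + real n powr (-1/4)"
        using elim by (simp add: divide_le_eq mult.commute)
      then have "\<bar>w n\<bar> * (real (num_distinct \<xi> n \<omega>) / real n)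
          \<le> \<bar>w n\<bar> * (truncated_mass p (1 / real n) + real n powr (-1/4))"
        by (intro mult_left_mono) auto
      also have "\<dots> \<le> \<bar>w n\<bar> * (\<bar>truncated_mass p (1 / real n)\<bar> + real n powr (-1/4))"
        by (intro mult_left_mono) auto
      finally show ?case by (simp add: abs_mult distrib_left)
    qed
    moreover have "(\<lambda>n. \<bar>w n * truncated_mass p (1 / real n)\<bar> + \<bar>w n * real n powr (-1/4)\<bar>)
        \<longlonglongrightarrow> 0"
      by (rule tendsto_add_zero; rule tendsto_rabs_zero) (rule mass w)+
    ultimately show "(\<lambda>n. w n / real n * real (num_distinct \<xi> n \<omega>)) \<longlonglongrightarrow> 0"
      by (rule Lim_null_comparison)
  qed
qed

section \<open>The lower estimate\<close>

text \<open>
  The event that samples \<open>i\<close> and \<open>j\<close> agree in a value of mass at most \<open>t\<close>. It is a union over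
  the countable support, because the event \<open>{\<omega>. \<xi> i \<omega> = \<xi> j \<omega>}\<close> itself need not be
  measurable when the type of values is larger than the continuum.
\<close>

definition collision :: "real \<Rightarrow> nat \<Rightarrow> nat \<Rightarrow> 'w set" where
  "collision t i j = (\<Union>x\<in>{x \<in> set_pmf p. pmf p x \<le> t}.
     (\<xi> i -` {x} \<inter> space M) \<inter> (\<xi> j -` {x} \<inter> space M))"

lemma sets_collision:
  assumes "i \<ge> 1" "j \<ge> 1"
  shows "collision t i j \<in> events"
  unfolding collision_def using assms
  by (intro sets.countable_UN' countable_subset[OF _ countable_set_pmf[of p]] sets.Int sets_sample) auto

text \<open>
  By independence the probability is the sum of the squares of the masses that are at most \<open>t\<close>,
  and each square is at most \<open>t\<close> times the mass.
\<close>

lemma prob_collision_le: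
  assumes "i \<ge> 1" "j \<ge> 1" "i \<noteq> j" "t \<ge> 0"
  shows "prob (collision t i j) \<le> t"
proof -
  define A where "A = {x \<in> set_pmf p. pmf p x \<le> t}"
  define B where "B x = (\<xi> i -` {x} \<inter> space M) \<inter> (\<xi> j -` {x} \<inter> space M)" for x
  have [simp]: "countable A"
    unfolding A_def by (rule countable_subset[OF _ countable_set_pmf[of p]]) auto
  have sets_B: "B x \<in> events" for x
    unfolding B_def using assms by (intro sets.Int sets_sample)
  have prob_B: "prob (B x) = pmf p x * pmf p x" for x
  proof -
    have "prob (\<Inter>k\<in>{i, j}. \<xi> k -` {x} \<inter> space M) = (\<Prod>k\<in>{i, j}. prob (\<xi> k -` {x} \<inter> space M))"
      by (rule indep_varsD[OF indep]) (use assms in auto)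
    then show ?thesis
      using assms by (simp add: B_def prob_sample measure_pmf_single)
  qed
  have "ennreal (prob (collision t i j)) = emeasure M (\<Union>x\<in>A. B x)"
    by (simp add: collision_def A_def B_def emeasure_eq_measure)
  also have "\<dots> = (\<integral>\<^sup>+x. emeasure M (B x) \<partial>count_space A)"
    by (rule emeasure_UN_countable[OF sets_B]) (auto simp: disjoint_family_on_def B_def)
  also have "\<dots> \<le> (\<integral>\<^sup>+x. ennreal t * ennreal (pmf p x) \<partial>count_space A)"
    by (intro nn_integral_mono)
      (auto simp: A_def emeasure_eq_measure prob_B ennreal_mult intro!: mult_right_mono ennreal_leI)
  also have "\<dots> = ennreal t * emeasure (measure_pmf p) A"
    by (simp add: nn_integral_cmult nn_integral_pmf)
  also have "\<dots> \<le> ennreal t * 1"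
    by (intro mult_left_mono measure_pmf.emeasure_le_1) auto
  finally show ?thesis using assms by simp
qed

text \<open>
  The fourth power makes the union bound over the at most \<open>n^2\<close> pairs summable in \<open>n\<close>.
\<close>

lemma AE_no_collision:
  "AE \<omega> in M. \<forall>\<^sub>F n in sequentially.
     inj_on (\<lambda>i. \<xi> i \<omega>) {i \<in> {1..n}. \<xi> i \<omega> \<in> {x. pmf p x \<le> 1 / real n ^ 4}}"
proof -
  define D where "D n = {(i, j). i \<in> {1..n} \<and> j \<in> {1..n} \<and> i \<noteq> j}" for n :: nat
  define C where "C n = (\<Union>(i, j)\<in>D n. collision (1 / real n ^ 4) i j)" for n
  have D_sub: "D n \<subseteq> {1..n} \<times> {1..n}" for n by (auto simp: D_def)
  have fin: "finite (D n)" for n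
    by (rule finite_subset[OF D_sub]) auto
  have card_D: "card (D n) \<le> n ^ 2" for n
    using card_mono[OF _ D_sub, of n] by (simp add: power2_eq_square)
  have sets_C: "C n \<in> events" for n
    unfolding C_def using fin by (intro sets.finite_UN) (auto simp: D_def intro!: sets_collision)
  have "prob (C n) \<le> inverse (real n ^ 2)" for n
  proof -
    have "prob (C n) \<le> (\<Sum>(i, j)\<in>D n. prob (collision (1 / real n ^ 4) i j))"
      unfolding C_def case_prod_beta
      using fin by (intro finite_measure_subadditive_finite) (auto simp: D_def intro!: sets_collision)
    also have "\<dots> \<le> (\<Sum>(i, j)\<in>D n. 1 / real n ^ 4)"
      by (intro sum_mono) (auto simp: D_def intro!: prob_collision_le)
    also have "\<dots> = real (card (D n)) * (1 / real n ^ 4)"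
      by simp
    also have "\<dots> \<le> real (n ^ 2) * (1 / real n ^ 4)"
      using card_D by (intro mult_right_mono) (auto simp del: of_nat_power)
    also have "\<dots> = inverse (real n ^ 2)"
      by (cases "n = 0") (auto simp: field_simps eval_nat_numeral)
    finally show ?thesis .
  qed
  then have "summable (\<lambda>n. prob (C n))"
    by (intro summable_comparison_test'[OF inverse_power_summable[of 2, where 'a=real]]) auto
  then have "AE \<omega> in M. \<forall>\<^sub>F n in sequentially. \<omega> \<in> space M - C n"
    using sets_C by (intro borel_cantelli_AE1) (auto simp: emeasure_eq_measure)
  \<comment> \<open>The collision events only register values in the support.\<close>
  moreover have "AE \<omega> in M. \<forall>i\<in>{1..}. \<xi> i \<omega> \<in> set_pmf p"
  proof (rule AE_ball_countable')
    fix i :: nat assume "i \<in> {1..}"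
    then have "prob (\<xi> i -` set_pmf p \<inter> space M) = 1"
      by (simp add: prob_sample measure_pmf.prob_eq_1 AE_measure_pmf)
    from AE_prob_1[OF this] show "AE \<omega> in M. \<xi> i \<omega> \<in> set_pmf p"
      by auto
  qed auto
  ultimately show ?thesis
  proof eventually_elim
    case (elim \<omega>)
    from elim(1) show ?case
    proof eventually_elim
      case (elim n)
      show ?case
      proof (rule inj_onI, rule ccontr)
        fix i j
        assume *: "i \<in> {i \<in> {1..n}. \<xi> i \<omega> \<in> {x. pmf p x \<le> 1 / real n ^ 4}}"
          "j \<in> {i \<in> {1..n}. \<xi> i \<omega> \<in> {x. pmf p x \<le> 1 / real n ^ 4}}"
          "\<xi> i \<omega> = \<xi> j \<omega>" "i \<noteq> j"
        then have "\<omega> \<in> collision (1 / real n ^ 4) i j"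
          using elim \<open>\<forall>i\<in>{1..}. \<xi> i \<omega> \<in> set_pmf p\<close> by (auto simp: collision_def)
        then show False
          using elim * by (auto simp: C_def D_def)
      qed
    qed
  qed
qed

text \<open>
  Without collisions, the light samples are counted by their values.
\<close>

lemma AE_num_distinct_ge:
  "AE \<omega> in M. \<forall>\<^sub>F n in sequentially.
     real n * measure_pmf.prob p {x. pmf p x \<le> 1 / real n ^ 4} - real n powr (3/4)
       \<le> real (num_distinct \<xi> n \<omega>)"
  using AE_no_collision AE_hits_close[of "\<lambda>n. {x. pmf p x \<le> 1 / real n ^ 4}"]
proof eventually_elim
  case (elim \<omega>)
  from elim(1) elim(2) show ?case
  proof eventually_elim
    case (elim n)
    let ?I = "{i \<in> {1..n}. \<xi> i \<omega> \<in> {x. pmf p x \<le> 1 / real n ^ 4}}"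
    have "hits {x. pmf p x \<le> 1 / real n ^ 4} n \<omega> = card ((\<lambda>i. \<xi> i \<omega>) ` ?I)"
      unfolding hits_def by (rule card_image[OF elim(1), symmetric])
    also have "\<dots> \<le> num_distinct \<xi> n \<omega>"
      unfolding num_distinct_def by (intro card_mono) auto
    finally show ?case using elim(2) by linarith
  qed
qed

text \<open>
  The null set comes from \<open>AE_num_distinct_ge\<close> alone, hence is the same for all \<open>\<epsilon>\<close>; for a
  sample path outside it the argument is deterministic.
\<close>

lemma AE_limsup_num_distinct_eq_top:
  assumes "pmf_entropy p = \<infinity>"
  shows "AE \<omega> in M. \<forall>\<epsilon>::real>0.
    limsup (\<lambda>n. ereal (ln (real n) powr (1 + \<epsilon>) / real n * real (num_distinct \<xi> n \<omega>))) = \<infinity>"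
  using AE_num_distinct_ge
proof eventually_elim
  case (elim \<omega>)
  define q where "q n = measure_pmf.prob p {x. pmf p x \<le> 1 / real n ^ 4}" for n
  show ?case
  proof (intro allI impI, rule ccontr)
    fix \<epsilon> :: real
    assume "\<epsilon> > 0"
      and "limsup (\<lambda>n. ereal (ln (real n) powr (1 + \<epsilon>) / real n * real (num_distinct \<xi> n \<omega>))) \<noteq> \<infinity>"
    then obtain c where
      "limsup (\<lambda>n. ereal (ln (real n) powr (1 + \<epsilon>) / real n * real (num_distinct \<xi> n \<omega>))) < ereal c"
      using less_PInf_Ex_of_nat by (metis ereal_infty_less(1))
    then have below_c: "\<forall>\<^sub>F n in sequentially.
        ln (real n) powr (1 + \<epsilon>) / real n * real (num_distinct \<xi> n \<omega>) < c"
      by (auto dest: Limsup_lessD)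
    have "(\<lambda>n. ln (real n) powr (1 + \<epsilon>) * real n powr (-1/4)) \<longlonglongrightarrow> 0"
      using \<open>\<epsilon> > 0\<close> by real_asymp
    then have "\<forall>\<^sub>F n in sequentially. ln (real n) powr (1 + \<epsilon>) * real n powr (-1/4) < 1"
      by (rule order_tendstoD) simp
    with below_c elim have "\<forall>\<^sub>F n in sequentially. ln (real n) powr (1 + \<epsilon>) * q n \<le> c + 1"
      using eventually_gt_at_top[of 0]
    proof eventually_elim
      case (elim n)
      have "real n powr (3/4) = real n * real n powr (-1/4)"
        using elim powr_add[of "real n" 1 "-1/4"] by simp
      then have "q n \<le> real (num_distinct \<xi> n \<omega>) / real n + real n powr (-1/4)"
        using elim by (simp add: q_def field_simps)
      then have "ln (real n) powr (1 + \<epsilon>) * q n \<le> ln (real n) powr (1 + \<epsilon>)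
          * (real (num_distinct \<xi> n \<omega>) / real n + real n powr (-1/4))"
        by (intro mult_left_mono) auto
      then show ?case using elim by (simp add: distrib_left)
    qed
    moreover have "filterlim (\<lambda>k. 2 ^ k :: nat) at_top sequentially"
      by (rule filterlim_subseq) (auto simp: strict_mono_def)
    \<comment> \<open>Sparse times \<open>2^k\<close> turn the power of \<open>ln n\<close> into a power of \<open>k\<close>.\<close>
    ultimately have dyadic: "\<forall>\<^sub>F k in sequentially. ln (real (2 ^ k)) powr (1 + \<epsilon>) * q (2 ^ k) \<le> c + 1"
      by (rule eventually_compose_filterlim)
    have "summable (\<lambda>k. q (2 ^ k))"
    proof (rule summable_comparison_test_ev)
      show "summable (\<lambda>k. (c + 1) / ln 2 powr (1 + \<epsilon>) * real k powr (- (1 + \<epsilon>)))"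
        using \<open>\<epsilon> > 0\<close> by (intro summable_mult) (simp add: summable_real_powr_iff)
      show "\<forall>\<^sub>F k in sequentially. norm (q (2 ^ k))
          \<le> (c + 1) / ln 2 powr (1 + \<epsilon>) * real k powr (- (1 + \<epsilon>))"
        using dyadic eventually_gt_at_top[of 0]
      proof eventually_elim
        case (elim k)
        have "ln (real (2 ^ k)) powr (1 + \<epsilon>) = real k powr (1 + \<epsilon>) * ln 2 powr (1 + \<epsilon>)"
          by (simp add: ln_realpow powr_mult)
        then have "q (2 ^ k) * (real k powr (1 + \<epsilon>) * ln 2 powr (1 + \<epsilon>)) \<le> c + 1"
          using elim by (simp add: mult.commute)
        then have "q (2 ^ k) \<le> (c + 1) / (real k powr (1 + \<epsilon>) * ln 2 powr (1 + \<epsilon>))"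
          using elim by (subst pos_le_divide_eq) auto
        moreover have "q (2 ^ k) \<ge> 0" by (simp add: q_def)
        ultimately show ?case
          unfolding powr_minus by (simp add: divide_inverse mult_ac)
      qed
    qed
    then have "pmf_entropy p < \<infinity>"
      unfolding q_def by (rule pmf_entropy_finite_if_summable)
    then show False using assms by simp
  qed
qed

end

section \<open>Growth of the number of distinct values\<close>

theorem theorem1:
  fixes p :: "'a pmf" and M :: "'w measure" and \<xi> :: "nat \<Rightarrow> 'w \<Rightarrow> 'a"
  assumes "prob_space M"
    and "prob_space.indep_vars M (\<lambda>_. count_space UNIV) \<xi> {1..}"
    and "\<And>i. i \<ge> 1 \<Longrightarrow> distr M (count_space UNIV) (\<xi> i) = measure_pmf p"
  shows "(AE \<omega> in M. (\<lambda>n. real (num_distinct \<xi> n \<omega>) / real n) \<longlonglongrightarrow> 0)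
    \<and> (pmf_entropy p < \<infinity> \<longrightarrow>
        (AE \<omega> in M. (\<lambda>n. ln (real n) / real n * real (num_distinct \<xi> n \<omega>)) \<longlonglongrightarrow> 0))
    \<and> (pmf_entropy p = \<infinity> \<longrightarrow>
        (AE \<omega> in M. \<forall>\<epsilon>::real>0.
          limsup (\<lambda>n. ereal (ln (real n) powr (1 + \<epsilon>) / real n * real (num_distinct \<xi> n \<omega>))) = \<infinity>))"
proof -
  interpret iid_pmf_samples M p \<xi>
    using assms by (simp add: iid_pmf_samples_def iid_pmf_samples_axioms_def)
  show ?thesis
  proof (intro conjI impI)
    have "(\<lambda>n. 1 * real n powr (-1/4)) \<longlonglongrightarrow> 0" by real_asymp
    from AE_weighted_num_distinct_tendsto_0[OF integrable_pmf[of UNIV p] _ this]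
    show "AE \<omega> in M. (\<lambda>n. real (num_distinct \<xi> n \<omega>) / real n) \<longlonglongrightarrow> 0" by simp
  next
    assume "pmf_entropy p < \<infinity>"
    from integrable_entropy_density[OF this]
    have g: "integrable (count_space UNIV) (\<lambda>x. pmf p x + - pmf p x * ln (pmf p x))"
      by (intro Bochner_Integration.integrable_add integrable_pmf)
    have bound: "\<bar>ln (real n)\<bar> * min (1 / real n) (pmf p x) \<le> pmf p x + - pmf p x * ln (pmf p x)" for n x
    proof (cases "n = 0")
      case True
      \<comment> \<open>At \<open>n = 0\<close> the left side vanishes, so only the sign of the majorant matters.\<close>
      then show ?thesis using order_trans[OF pmf_mult_ln_nonpos[of p x] pmf_nonneg[of p x]] by simp
    next
      case False
      then show ?thesis
        using ln_mult_min_le[of "pmf p x" n] by (simp add: pmf_le_1)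
    qed
    have "(\<lambda>n. ln (real n) * real n powr (-1/4)) \<longlonglongrightarrow> 0" by real_asymp
    from AE_weighted_num_distinct_tendsto_0[OF g bound this]
    show "AE \<omega> in M. (\<lambda>n. ln (real n) / real n * real (num_distinct \<xi> n \<omega>)) \<longlonglongrightarrow> 0" .
  next
    assume "pmf_entropy p = \<infinity>"
    then show "AE \<omega> in M. \<forall>\<epsilon>::real>0.
      limsup (\<lambda>n. ereal (ln (real n) powr (1 + \<epsilon>) / real n * real (num_distinct \<xi> n \<omega>))) = \<infinity>"
      by (rule AE_limsup_num_distinct_eq_top)
  qed
qed

end
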